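(* Let $T$ be a tree with a vertex $x_0$ such that, for some vertex $x_1\sim x_0$, the quantity $$\underline{m}(r)=\min_{\substack{x\in S_r(x_0)\\ d(x,x_1)=r-1}}m(x)\qquad(r\ge1)$$ satisfies $\underline{m}(r)>1$ for all $r\ge1$ and $$\sum_{r=1}^{\infty}\frac{1}{\underline{m}(r)}<\infty.$$ Then $T$ is stochastically incomplete.
   Context: All graphs are infinite, locally finite and connected; $d(x,y)$ is the number of edges in a shortest path from $x$ to $y$, $m(x)$ is the valence (number of edges at $x$), $y\sim x$ means $x,y$ are joined by an edge, and $S_r(x_0)=\{x: d(x,x_0)=r\}$. The combinatorial Laplacian is $\Delta f(x)=\sum_{y\sim x}(f(x)-f(y))$. The heat kernel $p_t(x,y)$ of a graph with vertex set $V$ is the smallest non-negative function on $V\times V\times[0,\infty)$ which is smooth in $t$, satisfies $\Delta p+\frac{\partial p}{\partial t}=0$ (with $\Delta$ in either vertex variable) and $p_0(x,y)=\delta_x(y)$. The graph is stochastically incomplete if $\sum_{y\in V}p_{t_0}(x_0,y)<1$ for some vertex $x_0$ and some $t_0>0$, and stochastically complete otherwise. *)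

theory Defs
  imports "HOL-Analysis.Analysis"
begin

(* A simple graph is given by its vertex set V and its adjacency relation E. *)

definition simple_graph :: "'a set \<Rightarrow> ('a \<Rightarrow> 'a \<Rightarrow> bool) \<Rightarrow> bool" where
  "simple_graph V E \<longleftrightarrow>
     (\<forall>x y. E x y \<longrightarrow> x \<in> V \<and> y \<in> V) \<and> (\<forall>x y. E x y \<longrightarrow> E y x) \<and> (\<forall>x. \<not> E x x)"

definition graph_path :: "'a set \<Rightarrow> ('a \<Rightarrow> 'a \<Rightarrow> bool) \<Rightarrow> 'a list \<Rightarrow> bool" where
  "graph_path V E xs \<longleftrightarrow> xs \<noteq> [] \<and> set xs \<subseteq> V \<and> distinct xs \<and> successively E xs"

definition path_between :: "'a set \<Rightarrow> ('a \<Rightarrow> 'a \<Rightarrow> bool) \<Rightarrow> 'a \<Rightarrow> 'a \<Rightarrow> 'a list \<Rightarrow> bool" where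
  "path_between V E x y xs \<longleftrightarrow> graph_path V E xs \<and> hd xs = x \<and> last xs = y"

definition connected_graph :: "'a set \<Rightarrow> ('a \<Rightarrow> 'a \<Rightarrow> bool) \<Rightarrow> bool" where
  "connected_graph V E \<longleftrightarrow> (\<forall>x\<in>V. \<forall>y\<in>V. \<exists>xs. path_between V E x y xs)"

(* A path with n edges is a list of n + 1 vertices. *)
definition graph_dist :: "'a set \<Rightarrow> ('a \<Rightarrow> 'a \<Rightarrow> bool) \<Rightarrow> 'a \<Rightarrow> 'a \<Rightarrow> nat" where
  "graph_dist V E x y = (LEAST n. \<exists>xs. path_between V E x y xs \<and> length xs = Suc n)"

definition graph_sphere :: "'a set \<Rightarrow> ('a \<Rightarrow> 'a \<Rightarrow> bool) \<Rightarrow> nat \<Rightarrow> 'a \<Rightarrow> 'a set" where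
  "graph_sphere V E r x0 = {x\<in>V. graph_dist V E x x0 = r}"

definition locally_finite_graph :: "'a set \<Rightarrow> ('a \<Rightarrow> 'a \<Rightarrow> bool) \<Rightarrow> bool" where
  "locally_finite_graph V E \<longleftrightarrow> (\<forall>x\<in>V. finite {y. E x y})"

definition valence :: "('a \<Rightarrow> 'a \<Rightarrow> bool) \<Rightarrow> 'a \<Rightarrow> nat" where
  "valence E x = card {y. E x y}"

(* The list holds the vertices of the cycle without repeating the first one at the end. *)
definition graph_cycle :: "'a set \<Rightarrow> ('a \<Rightarrow> 'a \<Rightarrow> bool) \<Rightarrow> 'a list \<Rightarrow> bool" where
  "graph_cycle V E xs \<longleftrightarrow> graph_path V E xs \<and> length xs \<ge> 3 \<and> E (last xs) (hd xs)"

definition infinite_lf_tree :: "'a set \<Rightarrow> ('a \<Rightarrow> 'a \<Rightarrow> bool) \<Rightarrow> bool" where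
  "infinite_lf_tree V E \<longleftrightarrow>
     simple_graph V E \<and> infinite V \<and> locally_finite_graph V E \<and> connected_graph V E \<and>
     (\<nexists>xs. graph_cycle V E xs)"

definition laplacian :: "('a \<Rightarrow> 'a \<Rightarrow> bool) \<Rightarrow> ('a \<Rightarrow> real) \<Rightarrow> 'a \<Rightarrow> real" where
  "laplacian E f x = (\<Sum>y | E x y. f x - f y)"

(* Smoothness on the closed half-line: D n is the n-th derivative, one-sided at 0. *)
definition smooth_halfline :: "(real \<Rightarrow> real) \<Rightarrow> bool" where
  "smooth_halfline f \<longleftrightarrow>
     (\<exists>D :: nat \<Rightarrow> real \<Rightarrow> real. (\<forall>t\<ge>0. D 0 t = f t) \<and>
        (\<forall>n. \<forall>t\<ge>0. (D n has_real_derivative D (Suc n) t) (at t within {0..})))"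

(* p t x y is only constrained for x, y in V and t >= 0. *)
definition heat_solution ::
  "'a set \<Rightarrow> ('a \<Rightarrow> 'a \<Rightarrow> bool) \<Rightarrow> (real \<Rightarrow> 'a \<Rightarrow> 'a \<Rightarrow> real) \<Rightarrow> bool" where
  "heat_solution V E p \<longleftrightarrow>
     (\<forall>x\<in>V. \<forall>y\<in>V.
        (\<forall>t\<ge>0. p t x y \<ge> 0) \<and>
        smooth_halfline (\<lambda>t. p t x y) \<and>
        (\<forall>t\<ge>0. \<exists>p'. ((\<lambda>s. p s x y) has_real_derivative p') (at t within {0..}) \<and>
                 laplacian E (\<lambda>z. p t z y) x + p' = 0 \<and>
                 laplacian E (\<lambda>z. p t x z) y + p' = 0) \<and>
        p 0 x y = (if x = y then 1 else 0))"

definition heat_kernel ::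
  "'a set \<Rightarrow> ('a \<Rightarrow> 'a \<Rightarrow> bool) \<Rightarrow> (real \<Rightarrow> 'a \<Rightarrow> 'a \<Rightarrow> real) \<Rightarrow> bool" where
  "heat_kernel V E p \<longleftrightarrow>
     heat_solution V E p \<and>
     (\<forall>q. heat_solution V E q \<longrightarrow> (\<forall>x\<in>V. \<forall>y\<in>V. \<forall>t\<ge>0. p t x y \<le> q t x y))"

lemma heat_kernel_unique:
  assumes "heat_kernel V E p" "heat_kernel V E q" "x \<in> V" "y \<in> V" "t \<ge> 0"
  shows "p t x y = q t x y"
  using assms unfolding heat_kernel_def by (meson order_antisym)

(* The summability conjunct matters: infsum is 0 for families that are not summable. *)
definition stochastically_incomplete :: "'a set \<Rightarrow> ('a \<Rightarrow> 'a \<Rightarrow> bool) \<Rightarrow> bool" where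
  "stochastically_incomplete V E \<longleftrightarrow>
     (\<exists>p. heat_kernel V E p \<and>
        (\<exists>x0\<in>V. \<exists>t0>0. (\<lambda>y. p t0 x0 y) summable_on V \<and> (\<Sum>\<^sub>\<infinity>y\<in>V. p t0 x0 y) < 1))"

definition min_valence ::
  "'a set \<Rightarrow> ('a \<Rightarrow> 'a \<Rightarrow> bool) \<Rightarrow> 'a \<Rightarrow> 'a \<Rightarrow> nat \<Rightarrow> nat" where
  "min_valence V E x0 x1 r =
     Min (valence E ` {x \<in> graph_sphere V E r x0. graph_dist V E x x1 = r - 1})"

end

(* The heat kernel is the increasing limit of the Dirichlet heat kernels p^A of finite balls A, and a
   minimum principle on A x [0, T] yields all comparisons. If v <= 1 satisfies Delta v <= - v, then
   comparing (e^t v - 1) / (e^T - 1) with 1 - sum_y p^A_t(., y) bounds the mass lost by time T from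
   below, uniformly in A, and the bound at x is positive once e^T v(x) > 1.
   Such a v lives on the branch of the tree behind x1: put v(x) = a(d(x, x0)) there and v = 0
   elsewhere, with a(r + 1) = a(r) (1 + 4 / m(r)), m(r) being the minimal valence. A branch vertex x at
   distance r has at most one neighbour nearer to x0, all others being branch vertices at
   distance r + 1, so Delta v(x) <= a(r) - (m(r) - 1) (4 / m(r)) a(r) <= - a(r) because m(r) >= 2.
   Summability of 1 / m(r) makes a bounded, so v can be normalised. *)

theory Submission
  imports Defs
begin

section \<open>Heat kernels by exhaustion\<close>

locale lf_graph =
  fixes V :: "'a set" and E :: "'a \<Rightarrow> 'a \<Rightarrow> bool"
  assumes simple: "simple_graph V E" and lf: "locally_finite_graph V E"
begin

lemma edge_in_V: "E x y \<Longrightarrow> x \<in> V" "E x y \<Longrightarrow> y \<in> V"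
  and edge_sym: "E x y \<Longrightarrow> E y x"
  and no_loop: "\<not> E x x"
  using simple unfolding simple_graph_def by blast+

lemma finite_nbrs [simp]: "finite {y. E x y}"
proof (cases "x \<in> V")
  case True
  then show ?thesis using lf unfolding locally_finite_graph_def by blast
next
  case False
  then have "{y. E x y} = {}" using edge_in_V by blast
  then show ?thesis by simp
qed

lemma laplacian_alt: "laplacian E f x = real (valence E x) * f x - (\<Sum>y | E x y. f y)"
  by (simp add: laplacian_def valence_def sum_subtractf)

lemma laplacian_diff: "laplacian E (\<lambda>z. f z - g z) x = laplacian E f x - laplacian E g x"
  by (simp add: laplacian_alt sum_subtractf algebra_simps)

lemma laplacian_const [simp]: "laplacian E (\<lambda>z. c) x = 0"
  by (simp add: laplacian_def)

lemma laplacian_cmult: "laplacian E (\<lambda>z. c * f z) x = c * laplacian E f x"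
  by (simp add: laplacian_alt sum_distrib_left[symmetric] algebra_simps)

lemma laplacian_sum: "laplacian E (\<lambda>z. \<Sum>i\<in>I. f i z) x = (\<Sum>i\<in>I. laplacian E (f i) x)"
  unfolding laplacian_def sum_subtractf[symmetric] by (rule sum.swap)

lemma has_real_derivative_laplacian:
  assumes "\<And>z. z \<in> V \<Longrightarrow> ((\<lambda>s. F s z) has_real_derivative F' z) (at t within S)" "x \<in> V"
  shows "((\<lambda>s. laplacian E (F s) x) has_real_derivative laplacian E F' x) (at t within S)"
  unfolding laplacian_def
  by (intro DERIV_sum DERIV_diff assms) (use edge_in_V in auto)

lemma abs_laplacian_le:
  assumes "\<And>z. z = x \<or> E x z \<Longrightarrow> \<bar>f z\<bar> \<le> B"
  shows "\<bar>laplacian E f x\<bar> \<le> 2 * real (valence E x) * B"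
proof -
  have "\<bar>laplacian E f x\<bar> \<le> (\<Sum>y | E x y. \<bar>f x - f y\<bar>)"
    unfolding laplacian_def by (rule sum_abs)
  also have "\<dots> \<le> (\<Sum>y | E x y. 2 * B)"
  proof (rule sum_mono)
    fix y assume "y \<in> {y. E x y}"
    then show "\<bar>f x - f y\<bar> \<le> 2 * B" using assms[of x] assms[of y] by auto
  qed
  finally show ?thesis by (simp add: valence_def)
qed

text \<open>If \<open>u\<close> were negative somewhere, \<open>u s z + \<epsilon> * s\<close> would
  have a negative minimum over \<open>A\<close> and \<open>[0, T]\<close>. There its time derivative
  and the Laplacian of \<open>u\<close> are both nonpositive, which the extra
  \<open>\<epsilon>\<close> makes incompatible with \<open>super\<close>.\<close>

lemma minimum_principle:
  assumes A: "finite A" "A \<subseteq> V"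
    and deriv: "\<And>x t. x \<in> A \<Longrightarrow> t \<in> {0..T} \<Longrightarrow>
      ((\<lambda>s. u s x) has_real_derivative u' t x) (at t within {0..T})"
    and super: "\<And>x t. x \<in> A \<Longrightarrow> t \<in> {0..T} \<Longrightarrow> u' t x + laplacian E (u t) x \<ge> 0"
    and init: "\<And>x. x \<in> A \<Longrightarrow> u 0 x \<ge> 0"
    and bdry: "\<And>x t. x \<in> V - A \<Longrightarrow> t \<in> {0..T} \<Longrightarrow> u t x \<ge> 0"
    and x: "x \<in> A" and t: "t \<in> {0..T}"
  shows "u t x \<ge> 0"
proof (rule ccontr)
  assume "\<not> u t x \<ge> 0"
  then have neg: "u t x < 0" by simp
  \<comment> \<open>Then \<open>u t x + \<epsilon> * t\<close> equals
    \<open>u t x / (t + 1)\<close>, which is still negative.\<close>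
  define \<epsilon> where "\<epsilon> = - u t x / (t + 1)"
  have \<epsilon>: "\<epsilon> > 0" using neg t by (simp add: \<epsilon>_def divide_neg_pos)
  have \<epsilon>t: "u t x + \<epsilon> * t < 0" using neg t by (simp add: \<epsilon>_def field_simps)
  define w where "w s z = u s z + \<epsilon> * s" for s z
  have dw: "((\<lambda>s. w s z) has_real_derivative u' s z + \<epsilon>) (at s within {0..T})"
    if "z \<in> A" "s \<in> {0..T}" for z s
    unfolding w_def by (rule derivative_eq_intros deriv that refl | simp)+
  have "\<exists>\<tau>\<in>{0..T}. \<forall>s\<in>{0..T}. w \<tau> z \<le> w s z" if "z \<in> A" for z
  proof (rule continuous_attains_inf)
    show "continuous_on {0..T} (\<lambda>s. w s z)"
      by (rule DERIV_continuous_on) (rule dw[OF that])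
  qed (use t in auto)
  then obtain \<tau> where \<tau>: "\<And>z. z \<in> A \<Longrightarrow> \<tau> z \<in> {0..T}"
    and \<tau>min: "\<And>z s. z \<in> A \<Longrightarrow> s \<in> {0..T} \<Longrightarrow> w (\<tau> z) z \<le> w s z"
    by metis
  obtain z where z: "z \<in> A" and zmin: "\<And>y. y \<in> A \<Longrightarrow> w (\<tau> z) z \<le> w (\<tau> y) y"
    using ex_is_arg_min_if_finite[of A "\<lambda>y. w (\<tau> y) y"] A(1) x
    by (fastforce simp: is_arg_min_linorder)
  define s where "s = \<tau> z"
  have s: "s \<in> {0..T}" using \<tau> z s_def by simp
  have min: "w s z \<le> w r y" if "y \<in> A" "r \<in> {0..T}" for y r
    using zmin[OF that(1)] \<tau>min[OF that] s_def by simp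
  have wneg: "w s z < 0" using min[OF x t] \<epsilon>t by (simp add: w_def)
  have "s \<noteq> 0" using wneg init[OF z] by (auto simp: w_def)
  then have spos: "s > 0" using s by simp
  \<comment> \<open>As \<open>s\<close> may be \<open>T\<close>, only earlier times are compared: a
    positive derivative would give smaller values just before \<open>s\<close>.\<close>
  have "u' s z + \<epsilon> \<le> 0"
  proof (rule ccontr)
    assume "\<not> u' s z + \<epsilon> \<le> 0"
    then obtain d where d: "d > 0"
      "\<And>h. h > 0 \<Longrightarrow> s - h \<in> {0..T} \<Longrightarrow> h < d \<Longrightarrow> w (s - h) z < w s z"
      using has_real_derivative_pos_inc_left[OF dw[OF z s]] by force
    define h where "h = min (d / 2) s"
    have "h > 0" "h < d" "s - h \<in> {0..T}" using d(1) spos s by (auto simp: h_def)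
    then show False using d(2)[of h] min[OF z, of "s - h"] by simp
  qed
  moreover have "laplacian E (u s) z \<le> 0"
    unfolding laplacian_def
  proof (rule sum_nonpos)
    fix y assume "y \<in> {y. E z y}"
    then have y: "y \<in> V" using edge_in_V by blast
    have "w s z \<le> w s y"
    proof (cases "y \<in> A")
      case True then show ?thesis using min s by blast
    next
      case False
      then have "u s y \<ge> 0" using bdry y s by blast
      then show ?thesis using wneg \<epsilon> spos by (simp add: w_def) (smt (verit) mult_pos_pos)
    qed
    then show "u s z - u s y \<le> 0" by (simp add: w_def)
  qed
  ultimately show False using super[OF z s] \<epsilon> by linarith
qed

section \<open>Dirichlet heat kernels of finite sets\<close>

definition dirichlet_gen :: "'a set \<Rightarrow> ('a \<Rightarrow> real) \<Rightarrow> 'a \<Rightarrow> real" where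
  "dirichlet_gen A f x = (if x \<in> A then - laplacian E f x else 0)"

text \<open>Column \<open>y\<close> of the \<open>k\<close>-th power of minus the Dirichlet
  Laplacian, zero if \<open>y\<close> is outside \<open>A\<close>. The generator resets values off
  \<open>A\<close> to 0 but keeps the full valence, so mass is lost along edges leaving
  \<open>A\<close>.\<close>

definition dirichlet_coeff :: "'a set \<Rightarrow> 'a \<Rightarrow> nat \<Rightarrow> 'a \<Rightarrow> real" where
  "dirichlet_coeff A y k = (dirichlet_gen A ^^ k) (\<lambda>x. if x = y \<and> x \<in> A then 1 else 0)"

text \<open>The matrix entries of \<open>exp (- t \<Delta>)\<close> for the Laplacian with Dirichlet condition off \<open>A\<close>.\<close>

definition dirichlet_kernel :: "'a set \<Rightarrow> real \<Rightarrow> 'a \<Rightarrow> 'a \<Rightarrow> real" where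
  "dirichlet_kernel A t x y = (\<Sum>k. dirichlet_coeff A y k x / fact k * t ^ k)"

lemma dirichlet_coeff_0: "dirichlet_coeff A y 0 x = (if x = y \<and> x \<in> A then 1 else 0)"
  and dirichlet_coeff_Suc: "dirichlet_coeff A y (Suc k) = dirichlet_gen A (dirichlet_coeff A y k)"
  by (simp_all add: dirichlet_coeff_def)

lemma dirichlet_coeff_outside: "x \<notin> A \<Longrightarrow> dirichlet_coeff A y k x = 0"
  by (cases k) (auto simp: dirichlet_coeff_0 dirichlet_coeff_Suc dirichlet_gen_def)

text \<open>Both functions vanish off \<open>A\<close>, so neighbour sums reduce to sums over
  \<open>A\<close>. What remains is a diagonal term and a sum over pairs that is symmetric because
  \<open>E\<close> is.\<close>

lemma dirichlet_gen_adjoint: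
  assumes A: "finite A" and f: "\<And>x. x \<notin> A \<Longrightarrow> f x = 0" and h: "\<And>x. x \<notin> A \<Longrightarrow> h x = 0"
  shows "(\<Sum>x\<in>A. dirichlet_gen A f x * h x) = (\<Sum>x\<in>A. f x * dirichlet_gen A h x)"
proof -
  have nbr: "(\<Sum>y | E x y. g y) = (\<Sum>y\<in>A. if E x y then g y else 0)"
    if "\<And>x. x \<notin> A \<Longrightarrow> g x = 0" for g :: "'a \<Rightarrow> real" and x
  proof -
    have "(\<Sum>y | E x y. g y) = (\<Sum>y\<in>A \<inter> {y. E x y}. g y)"
      by (rule sum.mono_neutral_right) (use that in auto)
    then show ?thesis by (simp add: sum.inter_restrict[OF A])
  qed
  have "(\<Sum>x\<in>A. \<Sum>y\<in>A. (if E x y then f y else 0) * h x)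
      = (\<Sum>x\<in>A. \<Sum>y\<in>A. f x * (if E x y then h y else 0))"
    by (subst sum.swap) (intro sum.cong, use edge_sym in auto)
  then show ?thesis
    by (simp add: dirichlet_gen_def laplacian_alt nbr[of f, OF f] nbr[of h, OF h] algebra_simps
        sum.distrib sum_subtractf sum_distrib_left sum_distrib_right)
qed

text \<open>The coefficient is the pairing of a power of the self-adjoint generator with two delta
  functions, and the powers move across one at a time.\<close>

lemma dirichlet_coeff_sym:
  assumes A: "finite A"
  shows "dirichlet_coeff A y k x = dirichlet_coeff A x k y"
proof -
  have adj: "(\<Sum>z\<in>A. dirichlet_coeff A y (j + i) z * dirichlet_coeff A x 0 z)
      = (\<Sum>z\<in>A. dirichlet_coeff A y j z * dirichlet_coeff A x i z)" for i j
  proof (induction i arbitrary: j)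
    case (Suc i)
    have "(\<Sum>z\<in>A. dirichlet_coeff A y (j + Suc i) z * dirichlet_coeff A x 0 z)
      = (\<Sum>z\<in>A. dirichlet_coeff A y (Suc j) z * dirichlet_coeff A x i z)"
      using Suc[of "Suc j"] by simp
    also have "\<dots> = (\<Sum>z\<in>A. dirichlet_coeff A y j z * dirichlet_coeff A x (Suc i) z)"
      unfolding dirichlet_coeff_Suc
      by (rule dirichlet_gen_adjoint[OF A]) (simp_all add: dirichlet_coeff_outside)
    finally show ?case .
  qed simp
  have pick: "(\<Sum>z\<in>A. g z * dirichlet_coeff A a 0 z) = g a"
    if "\<And>z. z \<notin> A \<Longrightarrow> g z = 0" for g :: "'a \<Rightarrow> real" and a
  proof -
    have "(\<Sum>z\<in>A. g z * dirichlet_coeff A a 0 z) = (\<Sum>z\<in>A. if z = a then g z else 0)"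
      by (rule sum.cong) (auto simp: dirichlet_coeff_0)
    then show ?thesis using that by (simp add: A sum.delta')
  qed
  have "dirichlet_coeff A y k x = (\<Sum>z\<in>A. dirichlet_coeff A y (0 + k) z * dirichlet_coeff A x 0 z)"
    by (simp add: pick dirichlet_coeff_outside)
  also have "\<dots> = (\<Sum>z\<in>A. dirichlet_coeff A x k z * dirichlet_coeff A y 0 z)"
    unfolding adj by (simp add: mult.commute)
  also have "\<dots> = dirichlet_coeff A x k y"
    by (simp add: pick dirichlet_coeff_outside)
  finally show ?thesis .
qed

text \<open>One application of the generator enlarges the supremum by at most twice the largest
  valence in \<open>A\<close>; a sum over \<open>A\<close> serves as a majorant of that
  maximum.\<close>

lemma dirichlet_coeff_bound:
  assumes A: "finite A"
  obtains C where "\<And>k x y. \<bar>dirichlet_coeff A y k x\<bar> \<le> C ^ k"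
proof
  fix k x y
  let ?C = "\<Sum>z\<in>A. 2 * real (valence E z)"
  show "\<bar>dirichlet_coeff A y k x\<bar> \<le> ?C ^ k"
  proof (induction k arbitrary: x)
    case 0
    then show ?case by (simp add: dirichlet_coeff_0)
  next
    case (Suc k)
    have C: "?C \<ge> 0" by (simp add: sum_nonneg)
    show ?case
    proof (cases "x \<in> A")
      case True
      have "\<bar>dirichlet_coeff A y (Suc k) x\<bar> \<le> 2 * real (valence E x) * ?C ^ k"
        using True Suc by (auto simp: dirichlet_coeff_Suc dirichlet_gen_def intro!: abs_laplacian_le)
      also have "\<dots> \<le> ?C * ?C ^ k"
        by (intro mult_right_mono member_le_sum[OF True] zero_le_power C) (use A in auto)
      finally show ?thesis by simp
    next
      case False
      then show ?thesis using C by (simp add: dirichlet_coeff_outside del: power_Suc)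
    qed
  qed
qed

lemma dirichlet_kernel_summable:
  assumes "finite A"
  shows "summable (\<lambda>k. dirichlet_coeff A y k x / fact k * t ^ k)"
proof -
  obtain C where C: "\<And>k x y. \<bar>dirichlet_coeff A y k x\<bar> \<le> C ^ k"
    using dirichlet_coeff_bound[OF assms] by blast
  show ?thesis
  proof (rule summable_comparison_test'[OF summable_exp[of "C * \<bar>t\<bar>"]])
    fix k :: nat
    have "\<bar>dirichlet_coeff A y k x\<bar> * \<bar>t\<bar> ^ k \<le> C ^ k * \<bar>t\<bar> ^ k"
      by (intro mult_right_mono C) simp
    then show "norm (dirichlet_coeff A y k x / fact k * t ^ k)
        \<le> inverse (fact k) * (C * \<bar>t\<bar>) ^ k"
      by (simp add: abs_mult power_abs power_mult_distrib field_simps)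
  qed
qed

lemma dirichlet_kernel_outside: "x \<notin> A \<Longrightarrow> dirichlet_kernel A t x y = 0"
  by (simp add: dirichlet_kernel_def dirichlet_coeff_outside)

lemma dirichlet_kernel_sym: "finite A \<Longrightarrow> dirichlet_kernel A t x y = dirichlet_kernel A t y x"
  by (simp add: dirichlet_kernel_def dirichlet_coeff_sym[of A x _ y])

lemma dirichlet_kernel_0: "dirichlet_kernel A 0 x y = (if x = y \<and> x \<in> A then 1 else 0)"
  unfolding dirichlet_kernel_def powser_zero by (simp add: dirichlet_coeff_0)

text \<open>Differentiating termwise shifts the coefficients, and on \<open>A\<close> the next
  coefficient is minus the Laplacian of the previous one.\<close>

lemma dirichlet_kernel_deriv:
  assumes A: "finite A" and x: "x \<in> A"
  shows "((\<lambda>s. dirichlet_kernel A s x y) has_real_derivative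
    - laplacian E (\<lambda>z. dirichlet_kernel A t z y) x) (at t within S)"
proof -
  have sums: "(\<lambda>k. dirichlet_coeff A y k z / fact k * t ^ k) sums dirichlet_kernel A t z y" for z
    unfolding dirichlet_kernel_def by (rule summable_sums[OF dirichlet_kernel_summable[OF A]])
  have "(\<lambda>k. - laplacian E (\<lambda>z. dirichlet_coeff A y k z / fact k * t ^ k) x)
      sums (- laplacian E (\<lambda>z. dirichlet_kernel A t z y) x)"
    unfolding laplacian_def by (intro sums_minus sums_sum sums_diff sums)
  moreover have "- laplacian E (\<lambda>z. dirichlet_coeff A y k z / fact k * t ^ k) x
      = diffs (\<lambda>k. dirichlet_coeff A y k x / fact k) k * t ^ k" for k
  proof -
    have "(\<lambda>z. dirichlet_coeff A y k z / fact k * t ^ k)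
        = (\<lambda>z. (t ^ k / fact k) * dirichlet_coeff A y k z)" by (simp add: mult.commute)
    then have "- laplacian E (\<lambda>z. dirichlet_coeff A y k z / fact k * t ^ k) x
        = (t ^ k / fact k) * dirichlet_coeff A y (Suc k) x"
      using x by (simp add: laplacian_cmult dirichlet_coeff_Suc dirichlet_gen_def
          del: times_divide_eq_left)
    then show ?thesis by (simp add: diffs_def del: of_nat_Suc)
  qed
  ultimately have "- laplacian E (\<lambda>z. dirichlet_kernel A t z y) x
      = (\<Sum>k. diffs (\<lambda>k. dirichlet_coeff A y k x / fact k) k * t ^ k)"
    by (simp add: sums_iff)
  moreover have "((\<lambda>s. dirichlet_kernel A s x y) has_real_derivative
     (\<Sum>k. diffs (\<lambda>k. dirichlet_coeff A y k x / fact k) k * t ^ k)) (at t)"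
    unfolding dirichlet_kernel_def
    by (rule termdiffs_strong_converges_everywhere) (rule dirichlet_kernel_summable[OF A])
  ultimately show ?thesis using has_field_derivative_at_within by metis
qed

lemma dirichlet_kernel_nonneg:
  assumes A: "finite A" "A \<subseteq> V" and "t \<ge> 0"
  shows "dirichlet_kernel A t x y \<ge> 0"
proof (cases "x \<in> A")
  case True
  show ?thesis
    by (rule minimum_principle[where T = t and u = "\<lambda>t x. dirichlet_kernel A t x y", OF A
          dirichlet_kernel_deriv[OF A(1)] _ _ _ True])
      (use assms in \<open>auto simp: dirichlet_kernel_0 dirichlet_kernel_outside\<close>)
qed (simp add: dirichlet_kernel_outside)

lemma dirichlet_kernel_le_1:
  assumes A: "finite A" "A \<subseteq> V" and "t \<ge> 0"
  shows "dirichlet_kernel A t x y \<le> 1"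
proof (cases "x \<in> A")
  case True
  have "1 - dirichlet_kernel A t x y \<ge> 0"
    by (rule minimum_principle[where T = t and u = "\<lambda>t x. 1 - dirichlet_kernel A t x y", OF A
          DERIV_diff[OF DERIV_const dirichlet_kernel_deriv[OF A(1)]] _ _ _ True])
      (use assms in \<open>auto simp: dirichlet_kernel_0 dirichlet_kernel_outside laplacian_diff\<close>)
  then show ?thesis by simp
qed (simp add: dirichlet_kernel_outside)

text \<open>On \<open>A\<close> the difference solves the heat equation with initial value 0; off
  \<open>A\<close> it is the kernel of \<open>B\<close>, hence nonnegative.\<close>

lemma dirichlet_kernel_mono:
  assumes A: "A \<subseteq> B" and B: "finite B" "B \<subseteq> V" and t: "t \<ge> 0"
  shows "dirichlet_kernel A t x y \<le> dirichlet_kernel B t x y"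
proof (cases "x \<in> A")
  case True
  have A': "finite A" "A \<subseteq> V" using A B finite_subset by auto
  have "dirichlet_kernel B t x y - dirichlet_kernel A t x y \<ge> 0"
    by (rule minimum_principle[where T = t and
          u = "\<lambda>t x. dirichlet_kernel B t x y - dirichlet_kernel A t x y", OF A'
          DERIV_diff[OF dirichlet_kernel_deriv[OF B(1)] dirichlet_kernel_deriv[OF A'(1)]] _ _ _ True])
      (use A B t dirichlet_kernel_nonneg[OF B] in
        \<open>auto simp: dirichlet_kernel_0 dirichlet_kernel_outside laplacian_diff\<close>)
  then show ?thesis by simp
qed (simp add: dirichlet_kernel_outside dirichlet_kernel_nonneg[OF B t])

text \<open>Minimality of the limit kernel rests on this comparison: the difference solves the heat
  equation on \<open>A\<close>, starts at 0 there, and equals \<open>q\<close> off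
  \<open>A\<close>.\<close>

lemma dirichlet_kernel_le_heat_solution:
  assumes A: "finite A" "A \<subseteq> V" and t: "t \<ge> 0" and q: "heat_solution V E q"
    and xy: "x \<in> V" "y \<in> V"
  shows "dirichlet_kernel A t x y \<le> q t x y"
proof (cases "x \<in> A")
  case True
  have dq: "((\<lambda>s. q s x y) has_real_derivative - laplacian E (\<lambda>z. q t z y) x) (at t within {0..T})"
    if "x \<in> A" "t \<in> {0..T}" for x t T
  proof -
    have "x \<in> V" "t \<ge> 0" using that A by auto
    then obtain p' where "((\<lambda>s. q s x y) has_real_derivative p') (at t within {0..})"
      "laplacian E (\<lambda>z. q t z y) x + p' = 0"
      using q xy unfolding heat_solution_def by blast
    moreover from this(2) have "p' = - laplacian E (\<lambda>z. q t z y) x" by linarith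
    ultimately show ?thesis by (auto elim: DERIV_subset)
  qed
  have "q t x y - dirichlet_kernel A t x y \<ge> 0"
    by (rule minimum_principle[where T = t and
          u = "\<lambda>t x. q t x y - dirichlet_kernel A t x y", OF A
          DERIV_diff[OF dq dirichlet_kernel_deriv[OF A(1)]] _ _ _ True])
      (use A q xy t in
        \<open>auto simp: dirichlet_kernel_0 dirichlet_kernel_outside laplacian_diff heat_solution_def\<close>)
  then show ?thesis by simp
next
  case False
  then show ?thesis using q xy t by (simp add: dirichlet_kernel_outside heat_solution_def)
qed

text \<open>With \<open>t\<close> in place of \<open>T\<close> in the exponential of the numerator, the left-hand side is a
  subsolution of the heat equation on \<open>[0, T]\<close> that is nonpositive at \<open>t = 0\<close> and at most \<open>1\<close>
  throughout; the right-hand side is a solution on \<open>A\<close> with initial value \<open>0\<close> there and value \<open>1\<close> off \<open>A\<close>.\<close>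

lemma dirichlet_mass_defect:
  assumes A: "finite A" "A \<subseteq> V" and T: "T > 0"
    and v1: "\<And>z. z \<in> V \<Longrightarrow> v z \<le> 1"
    and sub: "\<And>z. z \<in> V \<Longrightarrow> laplacian E v z \<le> - v z"
    and x: "x \<in> A"
  shows "(exp T * v x - 1) / (exp T - 1) \<le> 1 - (\<Sum>y\<in>A. dirichlet_kernel A T x y)"
proof -
  define c where "c = 1 / (exp T - 1)"
  have c: "c > 0" using T by (simp add: c_def)
  define u where "u t z = (1 - (\<Sum>y\<in>A. dirichlet_kernel A t z y)) - c * (exp t * v z - 1)" for t z
  have "u T x \<ge> 0"
  proof (rule minimum_principle[where T = T and A = A and u = u and
        u' = "\<lambda>t z. (\<Sum>y\<in>A. laplacian E (\<lambda>z. dirichlet_kernel A t z y) z) - c * (exp t * v z)"])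
    fix z t assume z: "z \<in> A" and t: "t \<in> {0..T}"
    show "((\<lambda>s. u s z) has_real_derivative
        (\<Sum>y\<in>A. laplacian E (\<lambda>z. dirichlet_kernel A t z y) z) - c * (exp t * v z)) (at t within {0..T})"
      unfolding u_def
      by (rule derivative_eq_intros dirichlet_kernel_deriv[OF A(1) z] refl | simp add: sum_negf)+
    have "laplacian E (u t) z = - (\<Sum>y\<in>A. laplacian E (\<lambda>z. dirichlet_kernel A t z y) z)
        - c * (exp t * laplacian E v z)"
      unfolding u_def by (simp add: laplacian_diff laplacian_cmult laplacian_sum)
    \<comment> \<open>Once the kernel sums cancel, the supersolution inequality is exactly this
      one.\<close>
    moreover have "c * (exp t * (laplacian E v z + v z)) \<le> 0"
      using sub[of z] z A c by (intro mult_nonneg_nonpos) auto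
    ultimately show "(\<Sum>y\<in>A. laplacian E (\<lambda>z. dirichlet_kernel A t z y) z) - c * (exp t * v z)
        + laplacian E (u t) z \<ge> 0"
      by (simp add: algebra_simps)
  next
    fix z assume z: "z \<in> A"
    have "(\<Sum>y\<in>A. dirichlet_kernel A 0 z y) = 1"
      using z A by (simp add: dirichlet_kernel_0)
    moreover have "c * (v z - 1) \<le> 0" using c v1[of z] z A by (intro mult_nonneg_nonpos) auto
    ultimately show "u 0 z \<ge> 0" by (simp add: u_def)
  next
    fix z t assume z: "z \<in> V - A" and t: "t \<in> {0..T}"
    \<comment> \<open>Since \<open>v z\<close> may be negative, it is bounded by 1 first, and only
      then is \<open>t\<close> replaced by \<open>T\<close>.\<close>
    have "exp t * v z \<le> exp T * 1"
      using mult_left_mono[OF v1[of z], of "exp t"] z t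
      by (auto intro: order_trans[of _ "exp t"])
    then have "c * (exp t * v z - 1) \<le> c * (exp T - 1)"
      using c by (intro mult_left_mono) auto
    also have "\<dots> = 1" using T by (simp add: c_def)
    finally show "u t z \<ge> 0" using z by (simp add: u_def dirichlet_kernel_outside)
  qed (use A x T in auto)
  then show ?thesis by (simp add: u_def c_def)
qed

end

text \<open>The uniform Lipschitz bound on the derivatives gives a quadratic Taylor estimate, which passes
  to the pointwise limit.\<close>

lemma has_real_derivative_limit:
  fixes f g :: "nat \<Rightarrow> real \<Rightarrow> real"
  assumes S: "convex S" and t: "t \<in> S"
    and deriv: "\<forall>\<^sub>F n in sequentially. \<forall>s\<in>S. (f n has_real_derivative g n s) (at s within S)"
    and lip: "\<forall>\<^sub>F n in sequentially. \<forall>r\<in>S. \<forall>s\<in>S. \<bar>g n r - g n s\<bar> \<le> C * \<bar>r - s\<bar>"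
    and f: "\<And>s. s \<in> S \<Longrightarrow> (\<lambda>n. f n s) \<longlonglongrightarrow> F s"
    and g: "(\<lambda>n. g n t) \<longlonglongrightarrow> G"
  shows "(F has_real_derivative G) (at t within S)"
proof -
  have quad: "\<bar>F s - F t - (s - t) * G\<bar> \<le> \<bar>C\<bar> * \<bar>s - t\<bar> * \<bar>s - t\<bar>" if s: "s \<in> S" for s
  proof (rule tendsto_upperbound)
    show "(\<lambda>n. \<bar>f n s - f n t - (s - t) * g n t\<bar>) \<longlonglongrightarrow> \<bar>F s - F t - (s - t) * G\<bar>"
      by (intro tendsto_intros f g s t)
    show "\<forall>\<^sub>F n in sequentially. \<bar>f n s - f n t - (s - t) * g n t\<bar> \<le> \<bar>C\<bar> * \<bar>s - t\<bar> * \<bar>s - t\<bar>"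
      using deriv lip
    proof eventually_elim
      case (elim n)
      let ?S = "closed_segment t s"
      have sub: "?S \<subseteq> S" using S s t by (simp add: closed_segment_subset)
      \<comment> \<open>Mean value inequality for \<open>f n\<close> minus the linear function of
        slope \<open>g n t\<close>; the derivative of this difference is at most
        \<open>\<bar>C\<bar> * \<bar>s - t\<bar>\<close> on the segment.\<close>
      have "norm ((f n s - s * g n t) - (f n t - t * g n t)) \<le> (\<bar>C\<bar> * \<bar>s - t\<bar>) * norm (s - t)"
      proof (rule field_differentiable_bound[of ?S "\<lambda>r. f n r - r * g n t" "\<lambda>r. g n r - g n t"])
        fix r assume r: "r \<in> ?S"
        show "((\<lambda>r. f n r - r * g n t) has_field_derivative g n r - g n t) (at r within ?S)"
          using elim(1) r sub by (auto intro!: derivative_eq_intros intro: DERIV_subset)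
        have "\<bar>g n r - g n t\<bar> \<le> C * \<bar>r - t\<bar>" using elim(2) r sub t by blast
        also have "\<dots> \<le> \<bar>C\<bar> * \<bar>r - t\<bar>" by (intro mult_right_mono) auto
        also have "\<dots> \<le> \<bar>C\<bar> * \<bar>s - t\<bar>"
          using r by (intro mult_left_mono) (auto simp: closed_segment_eq_real_ivl split: if_splits)
        finally show "norm (g n r - g n t) \<le> \<bar>C\<bar> * \<bar>s - t\<bar>" by simp
      qed auto
      then show ?case by (simp add: algebra_simps)
    qed
  qed simp
  have "((\<lambda>s. (F s - F t) / (s - t)) \<longlongrightarrow> G) (at t within S)"
  proof (rule LIM_zero_cancel, rule Lim_null_comparison)
    show "\<forall>\<^sub>F s in at t within S. norm ((F s - F t) / (s - t) - G) \<le> \<bar>C\<bar> * \<bar>s - t\<bar>"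
      unfolding eventually_at_filter
    proof (intro always_eventually allI impI)
      fix s assume s: "s \<noteq> t" "s \<in> S"
      have "(F s - F t) / (s - t) - G = (F s - F t - (s - t) * G) / (s - t)"
        using s by (simp add: field_simps)
      then show "norm ((F s - F t) / (s - t) - G) \<le> \<bar>C\<bar> * \<bar>s - t\<bar>"
        using quad[OF s(2)] s(1) by (simp add: divide_le_eq)
    qed
    show "((\<lambda>s. \<bar>C\<bar> * \<bar>s - t\<bar>) \<longlongrightarrow> 0) (at t within S)"
      by (auto intro!: tendsto_eq_intros)
  qed
  then show ?thesis by (simp add: has_field_derivative_iff)
qed

section \<open>The minimal heat kernel as a limit along an exhaustion\<close>

locale exhausted_graph = lf_graph +
  fixes A :: "nat \<Rightarrow> 'a set"
  assumes finite_A: "\<And>n. finite (A n)" and inc_A: "incseq A" and Un_A: "(\<Union>n. A n) = V"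
begin

lemma A_subset: "A n \<subseteq> V"
  using Un_A by blast

lemma eventually_in_A: "x \<in> V \<Longrightarrow> \<forall>\<^sub>F n in sequentially. x \<in> A n"
  using Un_A inc_A unfolding eventually_sequentially incseq_def by blast

text \<open>For \<open>t \<ge> 0\<close> the sequence increases and is at most 1, so
  \<open>lim\<close> is a genuine limit there.\<close>

definition min_kernel :: "real \<Rightarrow> 'a \<Rightarrow> 'a \<Rightarrow> real" where
  "min_kernel t x y = lim (\<lambda>n. dirichlet_kernel (A n) t x y)"

lemma min_kernel_lim:
  assumes "t \<ge> 0"
  shows "(\<lambda>n. dirichlet_kernel (A n) t x y) \<longlonglongrightarrow> min_kernel t x y"
proof -
  have "incseq (\<lambda>n. dirichlet_kernel (A n) t x y)"
    using inc_A assms by (auto simp: incseq_def intro!: dirichlet_kernel_mono finite_A A_subset)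
  then have "convergent (\<lambda>n. dirichlet_kernel (A n) t x y)"
    using incseq_convergent dirichlet_kernel_le_1[OF finite_A A_subset assms] convergentI by metis
  then show ?thesis by (simp add: min_kernel_def convergent_LIMSEQ_iff)
qed

lemma min_kernel_nonneg: "t \<ge> 0 \<Longrightarrow> min_kernel t x y \<ge> 0"
  using LIMSEQ_le_const[OF min_kernel_lim] dirichlet_kernel_nonneg[OF finite_A A_subset] by blast

lemma min_kernel_sym: "min_kernel t x y = min_kernel t y x"
  by (simp add: min_kernel_def dirichlet_kernel_sym[OF finite_A, of _ _ x y])

lemma min_kernel_0:
  assumes "x \<in> V"
  shows "min_kernel 0 x y = (if x = y then 1 else 0)"
proof (rule LIMSEQ_unique[OF min_kernel_lim])
  show "(\<lambda>n. dirichlet_kernel (A n) 0 x y) \<longlonglongrightarrow> (if x = y then 1 else 0)"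
    by (rule tendsto_eventually)
      (use eventually_in_A[OF assms] in eventually_elim, simp add: dirichlet_kernel_0)
qed simp

text \<open>On \<open>A n\<close> the derivative is minus the Laplacian of a function with values in
  \<open>[0, 1]\<close>, which gives a constant independent of \<open>n\<close>.\<close>

lemma dirichlet_kernel_lipschitz:
  assumes rs: "r \<ge> 0" "s \<ge> 0"
  shows "\<bar>dirichlet_kernel (A n) r x y - dirichlet_kernel (A n) s x y\<bar>
    \<le> 2 * real (valence E x) * \<bar>r - s\<bar>"
proof (cases "x \<in> A n")
  case True
  have "norm (dirichlet_kernel (A n) r x y - dirichlet_kernel (A n) s x y)
    \<le> 2 * real (valence E x) * norm (r - s)"
  proof (rule field_differentiable_bound[OF _ dirichlet_kernel_deriv[OF finite_A True]])
    fix t :: real assume "t \<in> {0..}"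
    then show "norm (- laplacian E (\<lambda>z. dirichlet_kernel (A n) t z y) x) \<le> 2 * real (valence E x)"
      using abs_laplacian_le[of x "\<lambda>z. dirichlet_kernel (A n) t z y" 1]
        dirichlet_kernel_le_1[OF finite_A A_subset] dirichlet_kernel_nonneg[OF finite_A A_subset]
      by simp
  qed (use rs in auto)
  then show ?thesis by simp
qed (simp add: dirichlet_kernel_outside)

text \<open>The derivatives of the approximants are Laplacians of functions that are Lipschitz in
  time uniformly in \<open>n\<close>, which is what \<open>has_real_derivative_limit\<close> asks
  for.\<close>

lemma min_kernel_deriv:
  assumes x: "x \<in> V" and t: "t \<ge> 0"
  shows "((\<lambda>s. min_kernel s x y) has_real_derivative - laplacian E (\<lambda>z. min_kernel t z y) x)
    (at t within {0..})"
proof (rule has_real_derivative_limit)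
  let ?f = "\<lambda>n s. dirichlet_kernel (A n) s x y"
  let ?g = "\<lambda>n s. - laplacian E (\<lambda>z. dirichlet_kernel (A n) s z y) x"
  define M where "M = 2 * real (\<Sum>z\<in>insert x {z. E x z}. valence E z)"
  show "\<forall>\<^sub>F n in sequentially. \<forall>s\<in>{0..}. (?f n has_real_derivative ?g n s) (at s within {0..})"
    using eventually_in_A[OF x] by eventually_elim (auto intro: dirichlet_kernel_deriv finite_A)
  show "\<forall>\<^sub>F n in sequentially. \<forall>r\<in>{0..}. \<forall>s\<in>{0..}.
      \<bar>?g n r - ?g n s\<bar> \<le> (2 * real (valence E x) * M) * \<bar>r - s\<bar>"
  proof (intro always_eventually allI ballI)
    fix n and r s :: real assume rs: "r \<in> {0..}" "s \<in> {0..}"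
    have "\<bar>laplacian E (\<lambda>z. dirichlet_kernel (A n) r z y - dirichlet_kernel (A n) s z y) x\<bar>
        \<le> 2 * real (valence E x) * (M * \<bar>r - s\<bar>)"
    proof (rule abs_laplacian_le)
      fix z assume "z = x \<or> E x z"
      then have "valence E z \<le> (\<Sum>z\<in>insert x {z. E x z}. valence E z)"
        by (intro member_le_sum) auto
      then have "2 * real (valence E z) \<le> M"
        unfolding M_def by linarith
      then have "2 * real (valence E z) * \<bar>r - s\<bar> \<le> M * \<bar>r - s\<bar>"
        by (intro mult_right_mono) auto
      then show "\<bar>dirichlet_kernel (A n) r z y - dirichlet_kernel (A n) s z y\<bar> \<le> M * \<bar>r - s\<bar>"
        using dirichlet_kernel_lipschitz[of r s n z y] rs by auto
    qed
    then show "\<bar>?g n r - ?g n s\<bar> \<le> (2 * real (valence E x) * M) * \<bar>r - s\<bar>"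
      by (simp add: laplacian_diff abs_minus_commute mult.assoc)
  qed
  show "(\<lambda>n. ?g n t) \<longlonglongrightarrow> - laplacian E (\<lambda>z. min_kernel t z y) x"
    unfolding laplacian_def by (intro tendsto_intros min_kernel_lim t)
qed (use t in \<open>auto intro: min_kernel_lim\<close>)

text \<open>The heat equation supplies every derivative: the \<open>n\<close>-th is the
  \<open>n\<close>-th iterate of minus the Laplacian in the first variable.\<close>

lemma min_kernel_smooth:
  assumes x: "x \<in> V"
  shows "smooth_halfline (\<lambda>t. min_kernel t x y)"
  unfolding smooth_halfline_def
proof (intro exI conjI allI impI)
  define L :: "('a \<Rightarrow> real) \<Rightarrow> 'a \<Rightarrow> real" where "L = (\<lambda>f x. - laplacian E f x)"
  let ?D = "\<lambda>n t. (L ^^ n) (\<lambda>z. min_kernel t z y)"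
  show "?D 0 t x = min_kernel t x y" for t by simp
  have "((\<lambda>s. ?D n s z) has_real_derivative ?D (Suc n) t z) (at t within {0..})"
    if "z \<in> V" "t \<ge> 0" for n z t
    using that
  proof (induction n arbitrary: z t)
    case 0
    then show ?case by (simp add: L_def min_kernel_deriv)
  next
    case (Suc n)
    have "((\<lambda>s. laplacian E (?D n s) z) has_real_derivative laplacian E (?D (Suc n) t) z)
        (at t within {0..})"
      by (rule has_real_derivative_laplacian) (use Suc in auto)
    then have "((\<lambda>s. - laplacian E (?D n s) z) has_real_derivative - laplacian E (?D (Suc n) t) z)
        (at t within {0..})"
      by (rule DERIV_minus)
    then show ?case by (simp add: L_def)
  qed
  then show "((\<lambda>s. ?D n s x) has_real_derivative ?D (Suc n) t x) (at t within {0..})"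
    if "t \<ge> 0" for n t using x that by blast
qed

lemma heat_solution_min_kernel: "heat_solution V E min_kernel"
  unfolding heat_solution_def
proof (intro ballI conjI allI impI)
  fix x y and t :: real assume x: "x \<in> V" and y: "y \<in> V"
  show "smooth_halfline (\<lambda>t. min_kernel t x y)" using x by (rule min_kernel_smooth)
  show "min_kernel 0 x y = (if x = y then 1 else 0)" using x by (rule min_kernel_0)
  assume t: "0 \<le> t"
  show "min_kernel t x y \<ge> 0" using t by (rule min_kernel_nonneg)
  have dx: "((\<lambda>s. min_kernel s x y) has_real_derivative - laplacian E (\<lambda>z. min_kernel t z y) x)
      (at t within {0..})" using x t by (rule min_kernel_deriv)
  have dy: "((\<lambda>s. min_kernel s x y) has_real_derivative - laplacian E (\<lambda>z. min_kernel t x z) y)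
      (at t within {0..})"
    using min_kernel_deriv[OF y t, of x] by (simp add: min_kernel_sym[of _ _ x])
  \<comment> \<open>Both formulas differentiate the same function. Derivatives are unique within
    \<open>{t<..}\<close>, which lies in the half-line and accumulates at \<open>t\<close>, even for
    \<open>t = 0\<close>.\<close>
  have "{t<..} \<subseteq> {0..}" using t by auto
  then have "laplacian E (\<lambda>z. min_kernel t z y) x = laplacian E (\<lambda>z. min_kernel t x z) y"
    using has_field_derivative_unique[OF DERIV_subset[OF dx] DERIV_subset[OF dy], of "{t<..}"] by simp
  then show "\<exists>p'. ((\<lambda>s. min_kernel s x y) has_real_derivative p') (at t within {0..}) \<and>
      laplacian E (\<lambda>z. min_kernel t z y) x + p' = 0 \<and>
      laplacian E (\<lambda>z. min_kernel t x z) y + p' = 0"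
    using dx by auto
qed

lemma heat_kernel_min_kernel: "heat_kernel V E min_kernel"
  unfolding heat_kernel_def
proof (intro conjI allI impI ballI heat_solution_min_kernel)
  fix q x y and t :: real
  assume "heat_solution V E q" "x \<in> V" "y \<in> V" "0 \<le> t"
  then show "min_kernel t x y \<le> q t x y"
    using LIMSEQ_le_const2[OF min_kernel_lim] dirichlet_kernel_le_heat_solution[OF finite_A A_subset]
    by blast
qed

text \<open>The mass defect bound on \<open>A n\<close> is independent of \<open>n\<close>, so it
  survives in the limit and keeps the total mass below 1.\<close>

lemma stochastically_incomplete_if_subharmonic:
  assumes v1: "\<And>z. z \<in> V \<Longrightarrow> v z \<le> 1"
    and sub: "\<And>z. z \<in> V \<Longrightarrow> laplacian E v z \<le> - v z"
    and x: "x \<in> V" and vx: "v x > 0"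
  shows "stochastically_incomplete V E"
proof -
  \<comment> \<open>Then \<open>exp T * v x = v x + 1\<close>, so the numerator of
    \<open>\<delta>\<close> is \<open>v x\<close>.\<close>
  define T where "T = ln (1 + 1 / v x)"
  have expT: "exp T = 1 + 1 / v x" using vx by (simp add: T_def add_pos_pos)
  have T: "T > 0" using vx by (simp add: T_def ln_gt_zero)
  define \<delta> where "\<delta> = (exp T * v x - 1) / (exp T - 1)"
  have "exp T * v x - 1 = v x" using vx by (simp add: expT algebra_simps)
  then have \<delta>: "\<delta> > 0" using vx by (simp add: \<delta>_def expT)
  \<comment> \<open>A finite \<open>F\<close> is eventually contained in \<open>A n\<close>. This
    bound yields both summability and the estimate of the infinite sum.\<close>
  have bound: "sum (min_kernel T x) F \<le> 1 - \<delta>" if F: "finite F" "F \<subseteq> V" for F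
  proof (rule tendsto_upperbound)
    show "(\<lambda>n. \<Sum>y\<in>F. dirichlet_kernel (A n) T x y) \<longlonglongrightarrow> sum (min_kernel T x) F"
      by (intro tendsto_sum min_kernel_lim) (use T in auto)
    have "\<forall>\<^sub>F n in sequentially. \<forall>y\<in>F. y \<in> A n"
      using F eventually_in_A by (intro eventually_ball_finite) auto
    then show "\<forall>\<^sub>F n in sequentially. (\<Sum>y\<in>F. dirichlet_kernel (A n) T x y) \<le> 1 - \<delta>"
      using eventually_in_A[OF x]
    proof eventually_elim
      case (elim n)
      have "(\<Sum>y\<in>F. dirichlet_kernel (A n) T x y) \<le> (\<Sum>y\<in>A n. dirichlet_kernel (A n) T x y)"
        using elim T by (intro sum_mono2 finite_A dirichlet_kernel_nonneg A_subset) auto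
      also have "\<dots> \<le> 1 - \<delta>"
        using dirichlet_mass_defect[OF finite_A A_subset T v1 sub elim(2)] by (simp add: \<delta>_def)
      finally show ?case .
    qed
  qed simp
  have summable: "min_kernel T x summable_on V"
    using min_kernel_nonneg T bound
    by (intro nonneg_bounded_partial_sums_imp_summable_on[where C = "1 - \<delta>"]
        eventually_finite_subsets_at_top_weakI) auto
  have "infsum (min_kernel T x) V \<le> 1 - \<delta>"
    using bound by (intro infsum_le_finite_sums summable)
  then show ?thesis
    unfolding stochastically_incomplete_def using heat_kernel_min_kernel summable x T \<delta> by force
qed

end

section \<open>Trees\<close>

locale lf_tree = lf_graph +
  assumes connected: "connected_graph V E" and acyclic: "\<nexists>xs. graph_cycle V E xs"
begin

text \<open>If two paths part right after their common start \<open>x\<close>, follow the first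
  until it first meets the second and return to \<open>x\<close> along the second: this closes a
  cycle.\<close>

lemma path_unique:
  assumes "path_between V E x z xs" "path_between V E x z ys"
  shows "xs = ys"
  using assms
proof (induction xs arbitrary: x ys)
  case Nil
  then show ?case by (simp add: path_between_def graph_path_def)
next
  case (Cons x' xs)
  note defs = path_between_def graph_path_def
  from Cons.prems(1) have [simp]: "x' = x" by (simp add: defs)
  from Cons.prems(2) obtain ys' where ys: "ys = x # ys'" by (cases ys) (auto simp: defs)
  show ?case
  proof (cases "xs = [] \<or> ys' = []")
    case True
    \<comment> \<open>One path has a single vertex, so \<open>z = x\<close>; as vertices do not
      repeat, the other path stops at once too.\<close>
    then show ?thesis
      using Cons.prems last_in_set[of xs] last_in_set[of ys'] by (auto simp: defs ys split: if_splits)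
  next
    case False
    have p: "path_between V E (hd xs) z xs" "path_between V E (hd ys') z ys'"
      using Cons.prems False by (auto simp: defs ys successively_Cons)
    have nx: "x \<notin> set xs" "x \<notin> set ys'" and xV: "x \<in> V"
      and Ex: "E x (hd xs)" "E x (hd ys')"
      using Cons.prems False by (auto simp: defs ys successively_Cons)
    have "hd xs = hd ys'"
    proof (rule ccontr)
      assume ne: "hd xs \<noteq> hd ys'"
      have "z \<in> set xs" "z \<in> set ys'"
        using p False last_in_set[of xs] last_in_set[of ys'] by (auto simp: defs)
      \<comment> \<open>\<open>c\<close> is the first vertex of \<open>xs\<close> on the other path,
        so \<open>ps\<close> is disjoint from \<open>ys'\<close> and the cycle below repeats no
        vertex.\<close>
      then obtain ps c ps' where xs: "xs = ps @ c # ps'" and c: "c \<in> set ys'"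
        and ps: "\<forall>y \<in> set ps. y \<notin> set ys'"
        using split_list_first_propE[of xs "\<lambda>y. y \<in> set ys'"] by blast
      obtain qs qs' where ys': "ys' = qs @ c # qs'" using c by (meson split_list)
      let ?cyc = "x # ps @ c # rev qs"
      \<comment> \<open>With \<open>ps\<close> and \<open>qs\<close> both empty, \<open>c\<close>
        would be the head of both paths.\<close>
      have "length ?cyc \<ge> 3" using ne by (cases ps; cases qs) (auto simp: xs ys')
      moreover have "E (last ?cyc) (hd ?cyc)"
        using Ex(2) edge_sym by (cases qs) (auto simp: ys')
      moreover have "distinct ?cyc" "set ?cyc \<subseteq> V"
        using p nx ps xV by (auto simp: defs xs ys')
      moreover have "successively E ?cyc"
      proof -
        have "successively E (ps @ [c])" "successively E (qs @ [c])"
          using p by (auto simp: defs xs ys' successively_append_iff successively_Cons)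
        moreover have "successively (\<lambda>x y. E y x) zs" if "successively E zs" for zs
          using that by (rule successively_mono) (use edge_sym in blast)
        ultimately have "successively E (ps @ [c])" "successively E (rev (qs @ [c]))"
          unfolding successively_rev by blast+
        moreover have "E x (hd (ps @ c # rev qs))" using Ex(1) by (cases ps) (auto simp: xs)
        ultimately show ?thesis
          by (auto simp: successively_append_iff successively_Cons)
      qed
      ultimately have "graph_cycle V E ?cyc" by (simp add: graph_cycle_def graph_path_def)
      then show False using acyclic by blast
    qed
    then have "xs = ys'" using Cons.IH p by metis
    then show ?thesis by (simp add: ys)
  qed
qed

text \<open>Paths in a tree are unique, so the minimum runs over a single length; the list counts
  vertices, whence \<open>Suc\<close>.\<close>

lemma graph_dist_path:
  assumes "path_between V E x z xs"
  shows "Suc (graph_dist V E x z) = length xs"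
proof -
  have "xs \<noteq> []" using assms by (simp add: path_between_def graph_path_def)
  moreover have "(\<exists>ys. path_between V E x z ys \<and> length ys = Suc n) \<longleftrightarrow> length xs = Suc n" for n
    using assms path_unique by blast
  ultimately show ?thesis
    by (cases xs) (simp_all add: graph_dist_def Least_equality)
qed

lemma graph_dist_commute:
  assumes "x \<in> V" "z \<in> V"
  shows "graph_dist V E x z = graph_dist V E z x"
proof -
  obtain xs where xs: "path_between V E x z xs"
    using connected assms unfolding connected_graph_def by blast
  have "successively (\<lambda>x y. E y x) xs"
    using xs unfolding path_between_def graph_path_def
    by (auto elim!: successively_mono intro: edge_sym)
  then have "path_between V E z x (rev xs)"
    using xs by (auto simp: path_between_def graph_path_def hd_rev last_rev)
  then show ?thesis using graph_dist_path[of z x] graph_dist_path[OF xs] by fastforce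
qed

lemma graph_dist_eq_0:
  assumes "x \<in> V" "z \<in> V" "graph_dist V E x z = 0"
  shows "x = z"
proof -
  obtain xs where xs: "path_between V E x z xs"
    using connected assms unfolding connected_graph_def by blast
  then have "length xs = 1" using graph_dist_path[OF xs] assms by simp
  then show ?thesis using xs by (auto simp: path_between_def length_Suc_conv)
qed

text \<open>Either the path from \<open>x\<close> to \<open>z\<close> passes through
  \<open>y\<close>, and uniqueness makes \<open>y\<close> its second vertex, or putting
  \<open>y\<close> in front of it gives the path from \<open>y\<close>.\<close>

lemma adjacent_path:
  assumes E: "E x y" and xs: "path_between V E x z xs" and ys: "path_between V E y z ys"
  shows "xs = x # ys \<or> ys = y # xs"
proof (cases "y \<in> set xs")
  case True
  then obtain ps qs where sp: "xs = ps @ y # qs" by (meson split_list)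
  have yx: "y \<noteq> x" using E no_loop by blast
  have p: "graph_path V E (ps @ y # qs)" "hd (ps @ y # qs) = x" "last (y # qs) = z"
    using xs by (simp_all add: path_between_def sp del: last.simps)
  have "x \<in> set ps" using p(2) yx by (cases ps) simp_all
  then have "path_between V E x z (x # y # qs)"
    using p E edge_in_V(1)[OF E] by (auto simp: path_between_def graph_path_def successively_append_iff)
  then have "xs = x # y # qs" using xs path_unique by blast
  moreover have "path_between V E y z (y # qs)"
    using p by (simp add: path_between_def graph_path_def successively_append_iff)
  then have "ys = y # qs" using ys path_unique by blast
  ultimately show ?thesis by simp
next
  case False
  then have "path_between V E y z (y # xs)"
    using xs edge_sym[OF E] edge_in_V(2)[OF E]
    by (simp add: path_between_def graph_path_def successively_Cons)
  then show ?thesis using ys path_unique by blast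
qed

lemma graph_dist_adjacent:
  assumes E: "E x y" and z: "z \<in> V"
  shows "graph_dist V E x z = Suc (graph_dist V E y z) \<or> graph_dist V E y z = Suc (graph_dist V E x z)"
proof -
  obtain xs ys where p: "path_between V E x z xs" "path_between V E y z ys"
    using connected z edge_in_V[OF E] unfolding connected_graph_def by meson
  then show ?thesis using adjacent_path[OF E p] graph_dist_path[OF p(1)] graph_dist_path[OF p(2)]
    by auto
qed

text \<open>Each such neighbour is the second vertex of the one path from \<open>x\<close> to
  \<open>z\<close>.\<close>

lemma parent_unique:
  assumes "E x y" "E x y'" and z: "z \<in> V"
    and "graph_dist V E x z = Suc (graph_dist V E y z)"
    and "graph_dist V E x z = Suc (graph_dist V E y' z)"
  shows "y = y'"
proof -
  obtain xs ys ys' where p: "path_between V E x z xs" "path_between V E y z ys"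
      "path_between V E y' z ys'"
    using connected z edge_in_V assms unfolding connected_graph_def by meson
  note d = graph_dist_path[OF p(1)] graph_dist_path[OF p(2)] graph_dist_path[OF p(3)]
  have "xs = x # ys" using adjacent_path[OF assms(1) p(1,2)] d assms(4) by auto
  moreover have "xs = x # ys'" using adjacent_path[OF assms(2) p(1,3)] d assms(5) by auto
  ultimately show ?thesis using p by (auto simp: path_between_def)
qed

lemma ex_parent:
  assumes x: "x \<in> V" and z: "z \<in> V" and d: "graph_dist V E x z = Suc n"
  obtains y where "E x y" "graph_dist V E y z = n"
proof -
  obtain xs where xs: "path_between V E x z xs"
    using connected x z unfolding connected_graph_def by blast
  then have "length xs = Suc (Suc n)" using graph_dist_path[OF xs] d by simp
  then obtain y ys where sp: "xs = x # y # ys"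
    using xs by (auto simp: path_between_def length_Suc_conv)
  then have p: "path_between V E y z (y # ys)" and E: "E x y"
    using xs by (auto simp: path_between_def graph_path_def)
  show ?thesis
    using that[OF E] graph_dist_path[OF p] sp \<open>length xs = Suc (Suc n)\<close> by simp
qed

text \<open>Every vertex at distance \<open>Suc r\<close> has a neighbour at distance
  \<open>r\<close>, and valences are finite. This makes balls finite and lets \<open>Min\<close> in
  \<open>min_valence\<close> range over a finite set.\<close>

lemma finite_sphere:
  assumes z: "z \<in> V"
  shows "finite (graph_sphere V E r z)"
proof (induction r)
  case 0
  have "graph_sphere V E 0 z \<subseteq> {z}"
    using graph_dist_eq_0 z by (auto simp: graph_sphere_def)
  then show ?case using finite_subset by blast
next
  case (Suc r)
  have "graph_sphere V E (Suc r) z \<subseteq> (\<Union>y\<in>graph_sphere V E r z. {x. E y x})"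
  proof
    fix x assume "x \<in> graph_sphere V E (Suc r) z"
    then have "x \<in> V" "graph_dist V E x z = Suc r" by (simp_all add: graph_sphere_def)
    then obtain y where y: "E x y" "graph_dist V E y z = r" using ex_parent z by blast
    then have "y \<in> graph_sphere V E r z" using edge_in_V(2)[OF y(1)] by (simp add: graph_sphere_def)
    then show "x \<in> (\<Union>y\<in>graph_sphere V E r z. {x. E y x})" using edge_sym[OF y(1)] by blast
  qed
  moreover have "finite (\<Union>y\<in>graph_sphere V E r z. {x. E y x})" using Suc by simp
  ultimately show ?case by (rule finite_subset)
qed

section \<open>Exhaustion by balls, and the branch behind \<open>x1\<close>\<close>

lemma exhausted_graph_balls:
  assumes z: "z \<in> V"
  shows "exhausted_graph V E (\<lambda>n. \<Union>r\<le>n. graph_sphere V E r z)"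
proof unfold_locales
  show "incseq (\<lambda>n. \<Union>r\<le>n. graph_sphere V E r z)"
    by (force simp: incseq_def intro: order_trans)
  show "finite (\<Union>r\<le>n. graph_sphere V E r z)" for n using finite_sphere[OF z] by simp
  show "(\<Union>n. \<Union>r\<le>n. graph_sphere V E r z) = V" by (auto simp: graph_sphere_def)
qed

text \<open>\<open>y\<close> is at distance \<open>d(x, x1) + 2\<close> from \<open>x0\<close>. Off
  the branch it would be at distance \<open>d(x, x1) + 3\<close> from \<open>x1\<close>, impossible
  for a neighbour of \<open>x\<close>.\<close>

lemma branch_child:
  assumes x01: "E x0 x1" and E: "E x y"
    and x: "graph_dist V E x x0 = Suc (graph_dist V E x x1)"
    and y: "graph_dist V E y x0 = Suc (graph_dist V E x x0)"
  shows "graph_dist V E y x0 = Suc (graph_dist V E y x1)"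
proof -
  have V: "x0 \<in> V" "x1 \<in> V" "y \<in> V" using edge_in_V[OF x01] edge_in_V[OF E] by auto
  show ?thesis
    using graph_dist_adjacent[OF x01 V(3)] graph_dist_adjacent[OF E V(2)] x y
    unfolding graph_dist_commute[OF V(1,3)] graph_dist_commute[OF V(2,3)] by linarith
qed

text \<open>Off the branch \<open>v\<close> is 0 and its neighbouring values are nonnegative. On the
  branch the parent contributes at most \<open>a (d x)\<close> to the Laplacian, since
  \<open>v\<close> is nonnegative, and the children at most \<open>- 2 * a (d x)\<close>.\<close>

lemma branch_subharmonic:
  fixes a :: "nat \<Rightarrow> real"
  assumes x01: "E x0 x1"
    and min: "\<And>r. r \<ge> 1 \<Longrightarrow> min_valence V E x0 x1 r > 1"
    and a0: "a 0 \<ge> 0" "a 0 \<le> a 1"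
    and a_step: "\<And>r. r \<ge> 1 \<Longrightarrow> a (Suc r) = a r * (1 + 4 / real (min_valence V E x0 x1 r))"
    and x: "x \<in> V"
  defines "v \<equiv> \<lambda>x. if graph_dist V E x x0 = Suc (graph_dist V E x x1) then a (graph_dist V E x x0) else 0"
  shows "laplacian E v x \<le> - v x"
proof -
  define d where "d y = graph_dist V E y x0" for y
  define B where "B = {y. d y = Suc (graph_dist V E y x1)}"
  have v: "v y = (if y \<in> B then a (d y) else 0)" for y by (simp add: v_def d_def B_def)
  have a1: "a r \<ge> 0" if "r \<ge> 1" for r
    using that by (induction r rule: dec_induct) (use a0 a_step in auto)
  have a: "a r \<ge> 0" for r using a1[of r] a0 by (cases r) auto
  have vnn: "v y \<ge> 0" for y by (simp add: v a)
  have x0V: "x0 \<in> V" using edge_in_V(1)[OF x01] .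
  show ?thesis
  proof (cases "x \<in> B")
    case False
    then have "v x = 0" by (simp add: v)
    then show ?thesis by (simp add: laplacian_alt vnn sum_nonneg)
  next
    case True
    define m where "m = min_valence V E x0 x1 (d x)"
    have r: "d x \<ge> 1" using True by (simp add: B_def)
    have m1: "m > 1" using min r by (simp add: m_def)
    have "x \<in> {x \<in> graph_sphere V E (d x) x0. graph_dist V E x x1 = d x - 1}"
      using x True by (auto simp: graph_sphere_def d_def B_def)
    then have m: "m \<le> valence E x"
      unfolding m_def min_valence_def
      using finite_sphere[OF x0V] by (intro Min_le finite_imageI) auto
    let ?P = "{y. E x y \<and> d x = Suc (d y)}" and ?C = "{y. E x y \<and> d y = Suc (d x)}"
    have "\<not> (d x = Suc (d y) \<and> d y = Suc (d x))" for y by linarith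
    moreover have "d x = Suc (d y) \<or> d y = Suc (d x)" if "E x y" for y
      unfolding d_def by (rule graph_dist_adjacent[OF that x0V])
    ultimately have split: "{y. E x y} = ?P \<union> ?C" "?P \<inter> ?C = {}" by blast+
    have fin: "finite ?P" "finite ?C" by (auto intro: finite_subset[OF _ finite_nbrs[of x]])
    have "card ?P \<le> 1"
      using parent_unique[OF _ _ x0V, of x]
      by (auto simp: card_le_Suc0_iff_eq fin d_def)
    moreover have "valence E x = card ?P + card ?C"
      unfolding valence_def split(1) by (rule card_Un_disjoint) (use fin split in auto)
    ultimately have cC: "real (card ?C) \<ge> real m - 1" and cP: "real (card ?P) \<le> 1" using m by auto
    have child: "v y = a (Suc (d x))" if "y \<in> ?C" for y
      using that branch_child[OF x01, of x y] True by (simp add: v B_def d_def)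
    have vx: "v x = a (d x)" using True by (simp add: v)
    have inc: "a (Suc (d x)) - a (d x) = a (d x) * (4 / real m)"
      using a_step[OF r] by (simp add: m_def algebra_simps)
    have "laplacian E v x = (\<Sum>y\<in>?P. v x - v y) + (\<Sum>y\<in>?C. v x - v y)"
      unfolding laplacian_def split(1) by (rule sum.union_disjoint) (use fin split in auto)
    also have "(\<Sum>y\<in>?C. v x - v y) = - (real (card ?C) * (a (d x) * (4 / real m)))"
      using inc by (simp add: child vx) (simp add: algebra_simps)
    also have "(\<Sum>y\<in>?P. v x - v y) \<le> real (card ?P) * a (d x)"
      using sum_bounded_above[of ?P "\<lambda>y. v x - v y" "a (d x)"] vnn vx by simp
    also have "real (card ?P) * a (d x) \<le> a (d x)" using mult_right_mono[OF cP a] by simp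
    also have "- (real (card ?C) * (a (d x) * (4 / real m))) \<le> - (2 * a (d x))"
    proof -
      \<comment> \<open>The factor 4 is chosen for this: \<open>m \<ge> 2\<close> gives
        \<open>(m - 1) / m \<ge> 1 / 2\<close>.\<close>
      have "2 * 1 \<le> (real m - 1) * (4 / real m)" using m1 by (simp add: field_simps)
      also have "\<dots> \<le> real (card ?C) * (4 / real m)" by (rule mult_right_mono[OF cC]) simp
      finally have "2 * a (d x) \<le> real (card ?C) * (4 / real m) * a (d x)"
        using a by (intro mult_right_mono) auto
      then show ?thesis by (simp add: algebra_simps)
    qed
    finally show ?thesis using vx by simp
  qed
qed

end

theorem theorem3p4p1:
  fixes V :: "'a set" and E :: "'a \<Rightarrow> 'a \<Rightarrow> bool" and x0 x1 :: 'a
  assumes "infinite_lf_tree V E"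
    and "x0 \<in> V"
    and "E x0 x1"
    and "\<And>r. r \<ge> 1 \<Longrightarrow> min_valence V E x0 x1 r > 1"
    and "summable (\<lambda>r. 1 / real (min_valence V E x0 x1 (Suc r)))"
  shows "stochastically_incomplete V E"
proof -
  interpret lf_tree V E
    using assms(1) by unfold_locales (auto simp: infinite_lf_tree_def)
  interpret exhausted_graph V E "\<lambda>n. \<Union>r\<le>n. graph_sphere V E r x0"
    by (rule exhausted_graph_balls) fact
  \<comment> \<open>Index shift: \<open>c k\<close> belongs to the radius
    \<open>k + 1\<close>.\<close>
  define c where "c k = 4 / real (min_valence V E x0 x1 (Suc k))" for k
  have c: "c k \<ge> 0" for k by (simp add: c_def)
  have sc: "summable c"
    using summable_mult[OF assms(5), of 4] by (simp add: c_def[abs_def])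
  define M where "M = exp (suminf c)"
  have bound: "(\<Prod>k<r. 1 + c k) \<le> M" for r
  proof -
    \<comment> \<open>By \<open>1 + c k \<le> exp (c k)\<close>, summability of \<open>c\<close>
      bounds all the products at once.\<close>
    have "(\<Prod>k<r. 1 + c k) \<le> (\<Prod>k<r. exp (c k))"
      using c by (intro prod_mono) (auto intro: add_nonneg_nonneg)
    also have "\<dots> = exp (\<Sum>k<r. c k)" by (simp add: exp_sum)
    also have "\<dots> \<le> M" using sum_le_suminf[OF sc] c by (simp add: M_def)
    finally show ?thesis .
  qed
  have M: "M > 0" by (simp add: M_def)
  \<comment> \<open>Division by \<open>M\<close> gives \<open>a r \<le> 1\<close>. The value
    \<open>a 0\<close> is a filler, since branch vertices are at distance at least 1 from
    \<open>x0\<close>.\<close>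
  define a where "a r = (case r of 0 \<Rightarrow> 0 | Suc k \<Rightarrow> (\<Prod>j<k. 1 + c j) / M)" for r
  have a_step: "a (Suc r) = a r * (1 + 4 / real (min_valence V E x0 x1 r))" if "r \<ge> 1" for r
    using that by (cases r) (auto simp: a_def c_def)
  have a_le: "a r \<le> 1" for r
    using bound M by (auto simp: a_def split: nat.split)
  define v where "v = (\<lambda>x. if graph_dist V E x x0 = Suc (graph_dist V E x x1)
    then a (graph_dist V E x x0) else 0)"
  have x1: "x1 \<in> V" using assms(3) edge_in_V by blast
  have p1: "path_between V E x1 x1 [x1]"
    using x1 by (simp add: path_between_def graph_path_def)
  have p2: "path_between V E x1 x0 [x1, x0]"
    using x1 assms(2,3) edge_sym no_loop by (auto simp: path_between_def graph_path_def)
  \<comment> \<open>\<open>x1\<close> is a branch vertex at distance 1 from \<open>x0\<close>, where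
    the product is empty.\<close>
  have "v x1 = 1 / M"
    using graph_dist_path[OF p1] graph_dist_path[OF p2] by (simp add: v_def a_def)
  show ?thesis
  proof (rule stochastically_incomplete_if_subharmonic)
    show "v x1 > 0" using \<open>v x1 = 1 / M\<close> M by simp
    show "v z \<le> 1" for z by (simp add: v_def a_le)
    show "laplacian E v z \<le> - v z" if "z \<in> V" for z
      unfolding v_def
      by (rule branch_subharmonic[OF assms(3,4) _ _ a_step that]) (use M in \<open>auto simp: a_def\<close>)
  qed (rule x1)
qed

end
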